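(* Let $P$ be a maximal ranked poset. Then the Chow polynomial $\underline{H}_P(t)$ and the augmented Chow polynomial $G_P(t)$ have only real zeros.
   Context: A maximal ranked poset is a finite bounded graded poset $P$ (least element $\widehat0$, greatest element $\widehat1$, rank function $\rho$ with $\rho(\widehat0)=0$) in which every rank level is nonempty and $x<y$ whenever $\rho(x)<\rho(y)$; equivalently, for a sequence of positive integers $c_1,\dots,c_n$, it has $c_i$ elements of rank $i$ for $1\le i\le n$, together with $\widehat0$ and $\widehat1$, and all order relations between elements of different ranks. Chow polynomial: with $\mu$ the Möbius function, $\chi_{[x,y]}(t)=\sum_{x\le z\le y}\mu(x,z)t^{\rho(y)-\rho(z)}$; $\overline{\chi}_{[x,x]}=-1$ and $\overline{\chi}_{[x,y]}=\chi_{[x,y]}/(t-1)$ for $x<y$; $\underline{H}_{[x,x]}=1$ and $\underline{H}_{[x,y]}=\sum_{x<z\le y}\overline{\chi}_{[x,z]}\underline{H}_{[z,y]}$ for $x<y$; $\underline{H}_P:=\underline{H}_{[\widehat0,\widehat1]}$. Augmented Chow polynomial: $G_P(t):=\sum_{z\in P}t^{\rho(z)}\underline{H}_{[z,\widehat1]}(t)$. *)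

theory Defs
  imports Complex_Main "HOL-Computational_Algebra.Polynomial"
begin

text \<open>
  A poset is given by its carrier \<open>P\<close> and its order relation \<open>r\<close>; \<open>lo\<close> and \<open>hi\<close> are the least and
  the greatest element. A rank function is normalised by \<open>\<rho> lo = 0\<close> and increases by one along
  every covering relation, so its values on \<open>P\<close> are determined by \<open>r\<close>.
\<close>

locale finite_bounded_graded_poset =
  fixes P :: "'a set" and r :: "'a rel" and lo hi :: 'a and \<rho> :: "'a \<Rightarrow> nat"
  assumes finite_carrier: "finite P"
    and partial_order: "partial_order_on P r"
    and lo_in: "lo \<in> P" and lo_least: "\<And>x. x \<in> P \<Longrightarrow> (lo, x) \<in> r"
    and hi_in: "hi \<in> P" and hi_greatest: "\<And>x. x \<in> P \<Longrightarrow> (x, hi) \<in> r"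
    and rank_lo: "\<rho> lo = 0"
    and rank_cover: "\<And>x y. (x, y) \<in> r \<Longrightarrow> x \<noteq> y \<Longrightarrow>
          (\<And>z. (x, z) \<in> r \<Longrightarrow> (z, y) \<in> r \<Longrightarrow> z = x \<or> z = y) \<Longrightarrow> \<rho> y = Suc (\<rho> x)"
begin

definition interval :: "'a \<Rightarrow> 'a \<Rightarrow> 'a set" where
  "interval x y = {z \<in> P. (x, z) \<in> r \<and> (z, y) \<in> r}"

lemma finite_interval: "finite (interval x y)"
  using finite_carrier by (simp add: interval_def)

lemma order_facts: "r \<subseteq> P \<times> P" "refl_on P r" "trans r" "antisym r"
  using partial_order by (auto simp: order_on_defs)

function mobius :: "'a \<Rightarrow> 'a \<Rightarrow> int" where
  "mobius x y = (if x = y then 1 else - (\<Sum>z \<in> interval x y - {y}. mobius x z))"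
  by pat_completeness auto
termination
proof (relation "measure (\<lambda>(x, y). card (interval x y))", goal_cases)
  case 1
  show ?case by simp
next
  case (2 x y z)
  then have z: "(x, z) \<in> r" "(z, y) \<in> r" "z \<noteq> y" by (auto simp: interval_def)
  then have xy: "y \<in> P" "(x, y) \<in> r" "(y, y) \<in> r" "(y, z) \<notin> r"
    using order_facts by (auto dest: transD antisymD refl_onD)
  have "interval x z \<subseteq> interval x y"
    using z order_facts(3) by (auto simp: interval_def dest: transD)
  moreover have "y \<in> interval x y" "y \<notin> interval x z"
    using xy by (auto simp: interval_def)
  ultimately have "interval x z \<subset> interval x y" by blast
  then show ?case by (simp add: psubset_card_mono finite_interval)
qed

declare mobius.simps [simp del]

definition char_poly_on :: "'a \<Rightarrow> 'a \<Rightarrow> real poly" where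
  "char_poly_on x y = (\<Sum>z \<in> interval x y. monom (of_int (mobius x z)) (\<rho> y - \<rho> z))"

definition reduced_char_poly_on :: "'a \<Rightarrow> 'a \<Rightarrow> real poly" where
  "reduced_char_poly_on x y = (if x = y then -1 else char_poly_on x y div [:-1, 1:])"

text \<open>For \<open>x < y\<close> the division by \<open>t - 1\<close> leaves no remainder, as the next lemma confirms.\<close>

lemma reduced_char_poly_on_mult:
  assumes "(x, y) \<in> r" "x \<noteq> y"
  shows "char_poly_on x y = [:-1, 1:] * reduced_char_poly_on x y"
proof -
  have y: "y \<in> interval x y"
    using assms order_facts by (auto simp: interval_def dest: refl_onD)
  have "poly (char_poly_on x y) 1 = real_of_int (\<Sum>z \<in> interval x y. mobius x z)"
    by (simp add: char_poly_on_def poly_sum poly_monom)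
  also have "(\<Sum>z \<in> interval x y. mobius x z)
      = mobius x y + (\<Sum>z \<in> interval x y - {y}. mobius x z)"
    using y by (simp add: sum.remove finite_interval)
  also have "\<dots> = 0"
    using assms by (simp add: mobius.simps[of x y])
  finally have "[:-1, 1:] dvd char_poly_on x y"
    by (simp add: poly_eq_0_iff_dvd)
  then show ?thesis
    using assms by (simp add: reduced_char_poly_on_def dvd_mult_div_cancel del: mult_pCons_left)
qed

text \<open>\<open>chow_poly_on x y\<close> is the Chow polynomial of the interval from \<open>x\<close> to \<open>y\<close>.\<close>

function chow_poly_on :: "'a \<Rightarrow> 'a \<Rightarrow> real poly" where
  "chow_poly_on x y = (if x = y then 1
     else (\<Sum>z \<in> interval x y - {x}. reduced_char_poly_on x z * chow_poly_on z y))"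
  by pat_completeness auto
termination
proof (relation "measure (\<lambda>(x, y). card (interval x y))", goal_cases)
  case 1
  show ?case by simp
next
  case (2 x y z)
  then have z: "(x, z) \<in> r" "(z, y) \<in> r" "z \<noteq> x" by (auto simp: interval_def)
  then have xy: "x \<in> P" "(x, y) \<in> r" "(x, x) \<in> r" "(z, x) \<notin> r"
    using order_facts by (auto dest: transD antisymD refl_onD)
  have "interval z y \<subseteq> interval x y"
    using z order_facts(3) by (auto simp: interval_def dest: transD)
  moreover have "x \<in> interval x y" "x \<notin> interval z y"
    using xy by (auto simp: interval_def)
  ultimately have "interval z y \<subset> interval x y" by blast
  then show ?case by (simp add: psubset_card_mono finite_interval)
qed

declare chow_poly_on.simps [simp del]

definition chow_poly :: "real poly" where
  "chow_poly = chow_poly_on lo hi"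

definition augmented_chow_poly :: "real poly" where
  "augmented_chow_poly = (\<Sum>z \<in> P. monom 1 (\<rho> z) * chow_poly_on z hi)"

end

locale maximal_ranked_poset = finite_bounded_graded_poset +
  assumes level_nonempty: "\<And>i. i \<le> \<rho> hi \<Longrightarrow> \<exists>x \<in> P. \<rho> x = i"
    and rank_less: "\<And>x y. x \<in> P \<Longrightarrow> y \<in> P \<Longrightarrow> \<rho> x < \<rho> y \<Longrightarrow> (x, y) \<in> r"

definition only_real_zeros :: "real poly \<Rightarrow> bool" where
  "only_real_zeros p \<longleftrightarrow> (\<forall>z. poly (map_poly complex_of_real p) z = 0 \<longrightarrow> z \<in> \<real>)"

end

theory Submission
  imports Defs
begin

text \<open>
  Let \<open>c\<^sub>i\<close> be the number of elements of rank \<open>i\<close> and \<open>N\<close> the rank of the poset. The Moebius function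
  is a product of factors \<open>1 - c\<^sub>i\<close>, and summing out the Chow recursion shows that the Chow
  polynomials \<open>H\<^sub>i\<close> of the upper intervals above rank \<open>i\<close> satisfy
  \<open>H\<^sub>i = (1 + t) H\<^sub>i\<^sub>+\<^sub>1 + t (c\<^sub>i\<^sub>+\<^sub>2 - 1) H\<^sub>i\<^sub>+\<^sub>2\<close> with \<open>H\<^sub>N = H\<^sub>N\<^sub>-\<^sub>1 = 1\<close>; the augmented Chow polynomial
  is the next term of the same recurrence. If \<open>t\<close> is not real, it has a square root \<open>s\<close> with
  \<open>Re s > 0\<close>. The quotients \<open>w\<^sub>i = H\<^sub>i / (s H\<^sub>i\<^sub>+\<^sub>1)\<close> then satisfy
  \<open>w\<^sub>i = s + 1/s + (c\<^sub>i\<^sub>+\<^sub>2 - 1) / w\<^sub>i\<^sub>+\<^sub>1\<close>, so all of them stay in the right half plane and no term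
  vanishes at \<open>t\<close>.
\<close>

section \<open>Zeros of the three-term recurrence\<close>

fun three_term :: "'a::comm_ring_1 \<Rightarrow> (nat \<Rightarrow> 'a) \<Rightarrow> nat \<Rightarrow> 'a" where
  "three_term t b 0 = 1"
| "three_term t b (Suc 0) = 1 + t"
| "three_term t b (Suc (Suc k)) = (1 + t) * three_term t b (Suc k) + t * b k * three_term t b k"

lemma three_term_nonzero:
  fixes t :: complex and b :: "nat \<Rightarrow> real"
  assumes t: "t \<notin> \<real>" and b: "\<And>k. b k \<ge> 0"
  shows "three_term t (\<lambda>k. of_real (b k)) k \<noteq> 0"
proof -
  define s where "s = csqrt t"
  let ?h = "three_term t (\<lambda>k. of_real (b k))"
  have s2: "s * s = t"
    unfolding s_def by (metis power2_csqrt power2_eq_square)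
  \<comment> \<open>A purely imaginary \<open>s\<close> would make \<open>t = s * s\<close> a
    nonpositive real.\<close>
  have "Re s \<noteq> 0"
  proof
    assume "Re s = 0"
    then have "Im t = 0" by (simp flip: s2)
    with t show False by (simp add: complex_is_Real_iff)
  qed
  moreover have "Re s \<ge> 0" unfolding s_def by (rule Re_csqrt)
  ultimately have pos: "Re s > 0" by simp
  then have s0: "s \<noteq> 0" by auto
  have Re_inv: "Re w > 0 \<Longrightarrow> Re (1 / w) > 0" for w :: complex
    by (auto simp: Re_divide power2_eq_square intro!: divide_pos_pos add_pos_nonneg)
  have Re_base: "Re ((1 + t) / s) > 0"
  proof -
    have "(1 + t) / s = 1 / s + s" using s0 by (simp add: field_simps flip: s2)
    then show ?thesis using pos Re_inv[OF pos] by simp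
  qed
  \<comment> \<open>The bound on the quotient carries the induction: a zero numerator would give
    real part 0, so positivity also keeps the next term nonzero.\<close>
  have "?h k \<noteq> 0 \<and> Re (?h (Suc k) / (s * ?h k)) > 0"
  proof (induction k)
    case 0
    then show ?case using Re_base by simp
  next
    case (Suc k)
    let ?w = "?h (Suc k) / (s * ?h k)"
    from Suc have k: "?h k \<noteq> 0" and w: "Re ?w > 0" by auto
    from w have Sk: "?h (Suc k) \<noteq> 0" by auto
    have "?h (Suc (Suc k)) / (s * ?h (Suc k)) = (1 + t) / s + of_real (b k) * (1 / ?w)"
      using s0 k Sk by (simp add: field_simps flip: s2)
    moreover have "Re (of_real (b k) * (1 / ?w)) = b k * Re (1 / ?w)"
      by (simp only: Re_complex_of_real Im_complex_of_real times_complex.sel mult_zero_left diff_zero)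
    moreover have "b k * Re (1 / ?w) \<ge> 0"
      using b[of k] Re_inv[OF w] by (intro mult_nonneg_nonneg) auto
    ultimately show ?case using Sk Re_base by simp
  qed
  then show ?thesis by blast
qed

lemma poly_three_term:
  "poly (map_poly complex_of_real (three_term [:0, 1:] (\<lambda>k. [:b k:]) k)) z
     = three_term z (\<lambda>k. of_real (b k)) k"
proof -
  have add: "map_poly complex_of_real (p + q) = map_poly of_real p + map_poly of_real q" for p q
    by (rule poly_eqI) (simp add: coeff_map_poly)
  have mult: "map_poly complex_of_real (p * q) = map_poly of_real p * map_poly of_real q" for p q
    by (rule poly_eqI) (simp add: coeff_map_poly coeff_mult)
  show ?thesis
    by (induction z "\<lambda>k. complex_of_real (b k)" k rule: three_term.induct)
      (simp_all add: add mult map_poly_pCons del: mult_pCons_left mult_pCons_right)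
qed

lemma only_real_zeros_three_term:
  assumes "\<And>k. b k \<ge> 0"
  shows "only_real_zeros (three_term [:0, 1:] (\<lambda>k. [:b k:]) k)"
  using three_term_nonzero[of _ b k] assms by (auto simp: only_real_zeros_def poly_three_term)

section \<open>Moebius function and characteristic polynomial in terms of level sizes\<close>

definition signed_prod :: "(nat \<Rightarrow> 'a::comm_ring_1) \<Rightarrow> nat \<Rightarrow> nat \<Rightarrow> 'a" where
  "signed_prod c i j = (\<Prod>l\<in>{i<..<j}. 1 - c l)"

lemma signed_prod_Suc_right:
  assumes "i < j" shows "signed_prod c i (Suc j) = (1 - c j) * signed_prod c i j"
proof -
  have "{i<..<Suc j} = insert j {i<..<j}" using assms by auto
  then show ?thesis by (simp add: signed_prod_def)
qed

lemma signed_prod_Suc_left: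
  assumes "Suc i < j" shows "signed_prod c i j = (1 - c (Suc i)) * signed_prod c (Suc i) j"
proof -
  have "{i<..<j} = insert (Suc i) {Suc i<..<j}" using assms by auto
  then show ?thesis by (simp add: signed_prod_def)
qed

lemma signed_prod_Suc_self [simp]: "signed_prod c i (Suc i) = 1"
proof -
  have "{i<..<Suc i} = {}" by auto
  then show ?thesis by (simp add: signed_prod_def)
qed

text \<open>With \<open>c\<close> the level sizes and \<open>i < j\<close>, this is the
  characteristic polynomial already divided by \<open>t - 1\<close>;
  \<open>signed_prod c i k\<close> is minus the Moebius function between ranks \<open>i < k\<close>.
  On the diagonal the sum is empty.\<close>

definition reduced_char :: "'a::comm_ring_1 \<Rightarrow> (nat \<Rightarrow> 'a) \<Rightarrow> nat \<Rightarrow> nat \<Rightarrow> 'a" where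
  "reduced_char t c i j = (\<Sum>k\<in>{i<..j}. signed_prod c i k * t ^ (j - k))"

lemma reduced_char_Suc_right:
  assumes "i \<le> j"
  shows "reduced_char t c i (Suc j) = t * reduced_char t c i j + signed_prod c i (Suc j)"
proof -
  have "{i<..Suc j} = insert (Suc j) {i<..j}" using assms by auto
  then show ?thesis
    by (simp add: reduced_char_def sum_distrib_left Suc_diff_le algebra_simps)
qed

lemma reduced_char_Suc_left:
  assumes "i < j"
  shows "reduced_char t c i j = t ^ (j - Suc i) + (1 - c (Suc i)) * reduced_char t c (Suc i) j"
proof -
  have "{i<..j} = insert (Suc i) {Suc i<..j}" using assms by auto
  then show ?thesis
    by (simp add: reduced_char_def sum_distrib_left signed_prod_Suc_left mult.assoc)
qed

text \<open>Since \<open>signed_prod c i (Suc k) = (1 - c k) * signed_prod c i k\<close>, each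
  summand is a difference of consecutive products, the first of which is 1.\<close>

lemma signed_prod_telescope:
  assumes "i < j"
  shows "(\<Sum>k\<in>{i<..<j}. c k * signed_prod c i k) = 1 - signed_prod c i j"
  using assms
proof (induction j)
  case (Suc j)
  show ?case
  proof (cases "i = j")
    case True
    moreover have "{j<..<Suc j} = {}" by auto
    ultimately show ?thesis by simp
  next
    case False
    with Suc.prems have "i < j" and "{i<..<Suc j} = insert j {i<..<j}" by auto
    with Suc.IH show ?thesis by (simp add: signed_prod_Suc_right algebra_simps)
  qed
qed simp

text \<open>Multiplying by \<open>t - 1\<close> takes differences of consecutive coefficients, which
  are \<open>- c k * signed_prod c i k\<close>. The right-hand side is the characteristic polynomial
  collected by rank: bottom element, inner levels, top element.\<close>

lemma reduced_char_telescope: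
  assumes "i < j"
  shows "(t - 1) * reduced_char t c i j =
    t ^ (j - i) - (\<Sum>k\<in>{i<..<j}. c k * (signed_prod c i k * t ^ (j - k))) - signed_prod c i j"
  using assms
proof (induction j)
  case (Suc j)
  show ?case
  proof (cases "i = j")
    case True
    moreover have "{j<..<Suc j} = {}" by auto
    moreover have "reduced_char t c j j = 0" by (simp add: reduced_char_def)
    ultimately show ?thesis by (simp add: reduced_char_Suc_right)
  next
    case False
    with Suc.prems have ij: "i < j" and ins: "{i<..<Suc j} = insert j {i<..<j}" by auto
    have shift: "(\<Sum>k\<in>{i<..<j}. c k * (signed_prod c i k * t ^ (Suc j - k)))
        = t * (\<Sum>k\<in>{i<..<j}. c k * (signed_prod c i k * t ^ (j - k)))" (is "?S' = t * ?S")
      by (auto simp: sum_distrib_left Suc_diff_le algebra_simps intro!: sum.cong)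
    have "(t - 1) * reduced_char t c i (Suc j) =
        t * ((t - 1) * reduced_char t c i j) + (t - 1) * signed_prod c i (Suc j)"
      using ij by (simp add: reduced_char_Suc_right algebra_simps)
    also have "\<dots> = t * (t ^ (j - i) - ?S - signed_prod c i j) + (t - 1) * signed_prod c i (Suc j)"
      using Suc.IH ij by simp
    also have "\<dots> = t * t ^ (j - i) - (c j * (signed_prod c i j * t) + t * ?S) - signed_prod c i (Suc j)"
      using ij by (simp add: signed_prod_Suc_right algebra_simps)
    finally show ?thesis
      using ij by (simp add: ins shift) (simp add: Suc_diff_le)
  qed
qed simp

section \<open>Solving the Chow recursion by ranks\<close>

definition tail_sum :: "'a::comm_ring_1 \<Rightarrow> (nat \<Rightarrow> 'a) \<Rightarrow> nat \<Rightarrow> (nat \<Rightarrow> 'a) \<Rightarrow> nat \<Rightarrow> 'a" where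
  "tail_sum t c N A i = (\<Sum>j\<in>{i..N}. c j * t ^ (j - i) * A j)"

lemma tail_sum_rec:
  assumes "i \<le> N"
  shows "tail_sum t c N A i = c i * A i + t * tail_sum t c N A (Suc i)"
proof -
  have "tail_sum t c N A i = c i * A i + (\<Sum>j\<in>{Suc i..N}. c j * t ^ (j - i) * A j)"
    using assms by (simp add: tail_sum_def sum.atLeast_Suc_atMost)
  moreover have "(\<Sum>j\<in>{Suc i..N}. c j * t ^ (j - i) * A j) = t * tail_sum t c N A (Suc i)"
    unfolding tail_sum_def sum_distrib_left
  proof (rule sum.cong)
    fix j assume "j \<in> {Suc i..N}"
    then have "j - i = Suc (j - Suc i)" by auto
    then show "c j * t ^ (j - i) * A j = t * (c j * t ^ (j - Suc i) * A j)"
      by (simp add: algebra_simps)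
  qed simp
  ultimately show ?thesis by simp
qed

text \<open>\<open>chow_seq t c N i\<close> is the Chow polynomial of the interval above an element of rank \<open>i\<close>. The
  truncated subtraction also gives the correct value \<open>1\<close> at \<open>i = N\<close>.\<close>

definition chow_seq :: "'a::comm_ring_1 \<Rightarrow> (nat \<Rightarrow> 'a) \<Rightarrow> nat \<Rightarrow> nat \<Rightarrow> 'a" where
  "chow_seq t c N i = three_term t (\<lambda>k. c (N - Suc k) - 1) (N - Suc i)"

lemma chow_seq_rec:
  assumes "Suc (Suc i) \<le> N" and "c N = 1"
  shows "chow_seq t c N i = (1 + t) * chow_seq t c N (Suc i)
    + t * (c (Suc (Suc i)) - 1) * chow_seq t c N (Suc (Suc i))"
proof (cases "Suc (Suc i) = N")
  \<comment> \<open>At \<open>i = N - 2\<close> the last term vanishes because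
    \<open>c N = 1\<close>, leaving \<open>1 + t\<close>.\<close>
  case True
  then show ?thesis using assms by (auto simp: chow_seq_def)
next
  case False
  with assms obtain k where N: "N = Suc (Suc (Suc (i + k)))"
    by (metis le_less less_imp_Suc_add add_Suc)
  then show ?thesis by (simp add: chow_seq_def Suc_diff_le)
qed

text \<open>By \<open>chow_seq_rec\<close>, the difference of the terms at \<open>i\<close> and
  \<open>Suc i\<close> is \<open>t * c (Suc (Suc i))\<close> times the term at
  \<open>Suc (Suc i)\<close>, plus \<open>t\<close> times the same difference one rank higher.
  Unrolling this gives the tail sum.\<close>

lemma chow_seq_tail_sum:
  assumes "i < N" and "c N = 1"
  shows "chow_seq t c N i = chow_seq t c N (Suc i)
    + t * tail_sum t c N (chow_seq t c N) (Suc (Suc i))"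
  using assms(1)
proof (induction "N - i" arbitrary: i)
  case (Suc d)
  show ?case
  proof (cases "Suc i = N")
    case True
    then show ?thesis by (auto simp: chow_seq_def tail_sum_def)
  next
    case False
    with Suc have i: "Suc (Suc i) \<le> N" "d = N - Suc i" "Suc i < N" by auto
    show ?thesis
      unfolding chow_seq_rec[of i N c, OF i(1) assms(2)] tail_sum_rec[OF i(1)]
      using Suc.hyps(1)[OF i(2,3)] by (simp add: algebra_simps)
  qed
qed simp

text \<open>The left-hand side is the defining recursion of the Chow polynomial, collected by rank.
  Peeling the lowest rank off \<open>reduced_char\<close> leaves a tail sum plus
  \<open>1 - c (Suc i)\<close> times the same convolution one rank higher.\<close>

lemma chow_seq_convolution:
  assumes "i < N" and "c N = 1"
  shows "(\<Sum>j\<in>{i<..N}. c j * (reduced_char t c i j * chow_seq t c N j)) = chow_seq t c N i"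
  using assms(1)
proof (induction "N - i" arbitrary: i)
  case (Suc d)
  let ?A = "chow_seq t c N"
  have ins: "{i<..N} = insert (Suc i) {Suc i<..N}" using Suc.prems by auto
  have "(\<Sum>j\<in>{i<..N}. c j * (reduced_char t c i j * ?A j))
      = (\<Sum>j\<in>{i<..N}. c j * t ^ (j - Suc i) * ?A j
          + (1 - c (Suc i)) * (c j * (reduced_char t c (Suc i) j * ?A j)))"
    by (intro sum.cong) (auto simp: reduced_char_Suc_left algebra_simps)
  also have "\<dots> = tail_sum t c N ?A (Suc i)
      + (1 - c (Suc i)) * (\<Sum>j\<in>{i<..N}. c j * (reduced_char t c (Suc i) j * ?A j))"
    by (simp add: sum.distrib sum_distrib_left tail_sum_def atLeastSucAtMost_greaterThanAtMost)
  \<comment> \<open>The term \<open>j = Suc i\<close> drops out, because its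
    \<open>reduced_char\<close> is an empty sum.\<close>
  also have "(\<Sum>j\<in>{i<..N}. c j * (reduced_char t c (Suc i) j * ?A j))
      = (\<Sum>j\<in>{Suc i<..N}. c j * (reduced_char t c (Suc i) j * ?A j))"
    by (simp add: ins) (simp add: reduced_char_def)
  also have "tail_sum t c N ?A (Suc i)
      + (1 - c (Suc i)) * (\<Sum>j\<in>{Suc i<..N}. c j * (reduced_char t c (Suc i) j * ?A j)) = ?A i"
  proof (cases "Suc i = N")
    case True
    then show ?thesis using assms by (auto simp: chow_seq_def tail_sum_def)
  next
    case False
    with Suc have i: "d = N - Suc i" "Suc i < N" by auto
    have "tail_sum t c N ?A (Suc i) = c (Suc i) * ?A (Suc i) + t * tail_sum t c N ?A (Suc (Suc i))"
      using i by (simp add: tail_sum_rec)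
    then show ?thesis
      unfolding Suc.hyps(1)[OF i] chow_seq_tail_sum[of i N c, OF Suc.prems assms(2)]
      by (simp add: algebra_simps)
  qed
  finally show ?case .
qed simp

text \<open>At index 0 the tail sum is the augmented Chow polynomial collected by rank. Eliminating
  the tail sum at 2 through \<open>chow_seq_tail_sum\<close> leaves one more step of the
  recurrence.\<close>

lemma tail_sum_chow_seq:
  assumes "c 0 = 1" and "c N = 1"
  shows "tail_sum t c N (chow_seq t c N) 0 = three_term t (\<lambda>k. c (N - Suc k) - 1) N"
proof (cases N)
  case 0
  then show ?thesis using assms by (simp add: tail_sum_def chow_seq_def)
next
  case (Suc M)
  let ?A = "chow_seq t c N"
  have "tail_sum t c N ?A 0 = ?A 0 + t * (c 1 * ?A 1 + t * tail_sum t c N ?A 2)"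
    using assms Suc tail_sum_rec[of 0 N t c ?A] tail_sum_rec[of 1 N t c ?A]
    by (simp add: numeral_2_eq_2)
  also have "\<dots> = (1 + t) * ?A 0 + t * (c 1 - 1) * ?A 1"
    using chow_seq_tail_sum[of 0 N c t] assms Suc by (simp add: numeral_2_eq_2 algebra_simps)
  \<comment> \<open>For \<open>N = 1\<close> the term with \<open>c 1 - 1\<close> vanishes since
    \<open>c N = 1\<close>.\<close>
  also have "\<dots> = three_term t (\<lambda>k. c (N - Suc k) - 1) N"
    using assms Suc by (cases M) (auto simp: chow_seq_def)
  finally show ?thesis .
qed

section \<open>Transfer from ranks to the poset\<close>

context maximal_ranked_poset
begin

text \<open>\<open>rank_cover\<close> speaks of covering pairs only; any other pair is split at an
  intermediate element into two smaller intervals.\<close>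

lemma rank_strict_mono:
  assumes "(x, y) \<in> r" "x \<noteq> y"
  shows "\<rho> x < \<rho> y"
  using assms
proof (induction "card (interval x y)" arbitrary: x y rule: less_induct)
  case less
  show ?case
  proof (cases "\<forall>z. (x, z) \<in> r \<longrightarrow> (z, y) \<in> r \<longrightarrow> z = x \<or> z = y")
    case True
    then show ?thesis using rank_cover less.prems by fastforce
  next
    case False
    then obtain z where z: "(x, z) \<in> r" "(z, y) \<in> r" "z \<noteq> x" "z \<noteq> y" by auto
    have P: "x \<in> P" "y \<in> P" "z \<in> P" using z order_facts(1) by auto
    have "(y, z) \<notin> r" "(z, x) \<notin> r"
      using z order_facts(4) by (auto dest: antisymD)
    then have "y \<notin> interval x z" "x \<notin> interval z y" "y \<in> interval x y" "x \<in> interval x y"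
      using P z less.prems order_facts(2) by (auto simp: interval_def dest: refl_onD)
    moreover have "interval x z \<subseteq> interval x y" "interval z y \<subseteq> interval x y"
      using z order_facts(3) by (auto simp: interval_def dest: transD)
    ultimately have "interval x z \<subset> interval x y" "interval z y \<subset> interval x y" by auto
    then have "card (interval x z) < card (interval x y)" "card (interval z y) < card (interval x y)"
      by (simp_all add: psubset_card_mono finite_interval)
    then show ?thesis using less.hyps z by (metis less_trans)
  qed
qed

lemma order_iff: "(x, y) \<in> r \<longleftrightarrow> x \<in> P \<and> y \<in> P \<and> (x = y \<or> \<rho> x < \<rho> y)"
  using rank_strict_mono rank_less order_facts(1,2) by (auto dest: refl_onD)

text \<open>Distinct elements of equal rank are incomparable, so the end ranks contribute only
  \<open>x\<close> and \<open>y\<close>, while the ranks in between contribute full levels.\<close>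

lemma interval_eq:
  assumes "x \<in> P" "y \<in> P" "\<rho> x < \<rho> y"
  shows "interval x y = insert x (insert y {z \<in> P. \<rho> z \<in> {\<rho> x<..<\<rho> y}})"
  using assms by (auto simp: interval_def order_iff)

definition level_size :: "nat \<Rightarrow> nat" where
  "level_size i = card {x \<in> P. \<rho> x = i}"

lemma level_size_lo: "level_size 0 = 1"
proof -
  have "{x \<in> P. \<rho> x = 0} = {lo}"
    using lo_in rank_lo lo_least rank_strict_mono by fastforce
  then show ?thesis by (simp add: level_size_def)
qed

lemma level_size_hi: "level_size (\<rho> hi) = 1"
proof -
  have "{x \<in> P. \<rho> x = \<rho> hi} = {hi}"
    using hi_in hi_greatest rank_strict_mono by fastforce
  then show ?thesis by (simp add: level_size_def)
qed

lemma level_size_pos: "i \<le> \<rho> hi \<Longrightarrow> level_size i > 0"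
  using level_nonempty[of i] finite_carrier by (auto simp: level_size_def card_gt_0_iff)

lemma rank_le_hi: "x \<in> P \<Longrightarrow> \<rho> x \<le> \<rho> hi"
  using hi_greatest[of x] by (auto simp: order_iff)

lemma sum_by_rank:
  fixes f :: "nat \<Rightarrow> 'b::comm_ring_1"
  assumes "finite J"
  shows "(\<Sum>z\<in>{z \<in> P. \<rho> z \<in> J}. f (\<rho> z)) = (\<Sum>j\<in>J. of_nat (level_size j) * f j)"
proof -
  have "(\<Sum>z\<in>{z \<in> P. \<rho> z \<in> J}. f (\<rho> z))
      = (\<Sum>j\<in>J. \<Sum>z\<in>{z \<in> {z \<in> P. \<rho> z \<in> J}. \<rho> z = j}. f (\<rho> z))"
    using assms finite_carrier by (intro sum.group[symmetric]) auto
  also have "\<dots> = (\<Sum>j\<in>J. of_nat (level_size j) * f j)"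
  proof (rule sum.cong)
    fix j assume "j \<in> J"
    then have "{z \<in> {z \<in> P. \<rho> z \<in> J}. \<rho> z = j} = {z \<in> P. \<rho> z = j}" by auto
    then show "(\<Sum>z\<in>{z \<in> {z \<in> P. \<rho> z \<in> J}. \<rho> z = j}. f (\<rho> z)) = of_nat (level_size j) * f j"
      by (simp add: level_size_def)
  qed simp
  finally show ?thesis .
qed

text \<open>By induction the Moebius recursion becomes a sum over inner levels that
  \<open>signed_prod_telescope\<close> evaluates; its 1 cancels the 1 contributed by
  \<open>x\<close>.\<close>

lemma mobius_eq:
  assumes "x \<in> P" "y \<in> P" "\<rho> x < \<rho> y"
  shows "mobius x y = - signed_prod (\<lambda>i. int (level_size i)) (\<rho> x) (\<rho> y)"
  using assms
proof (induction "\<rho> y" arbitrary: y rule: less_induct)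
  case less
  let ?c = "\<lambda>i. int (level_size i)"
  have "mobius x y = - (\<Sum>z\<in>interval x y - {y}. mobius x z)"
    using less.prems by (subst mobius.simps) auto
  also have "interval x y - {y} = insert x {z \<in> P. \<rho> z \<in> {\<rho> x<..<\<rho> y}}"
    using less.prems by (auto simp: interval_eq)
  also have "(\<Sum>z\<in>\<dots>. mobius x z) = 1 + (\<Sum>z\<in>{z \<in> P. \<rho> z \<in> {\<rho> x<..<\<rho> y}}. mobius x z)"
    using finite_carrier by (simp add: mobius.simps[of x x])
  also have "(\<Sum>z\<in>{z \<in> P. \<rho> z \<in> {\<rho> x<..<\<rho> y}}. mobius x z)
      = (\<Sum>z\<in>{z \<in> P. \<rho> z \<in> {\<rho> x<..<\<rho> y}}. - signed_prod ?c (\<rho> x) (\<rho> z))"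
    using less by (intro sum.cong) auto
  also have "\<dots> = - (\<Sum>j\<in>{\<rho> x<..<\<rho> y}. ?c j * signed_prod ?c (\<rho> x) j)"
    unfolding sum_negf by (subst sum_by_rank) simp_all
  also have "\<dots> = - (1 - signed_prod ?c (\<rho> x) (\<rho> y))"
    using less.prems by (simp add: signed_prod_telescope)
  finally show ?case by simp
qed

lemma reduced_char_poly_on_eq:
  assumes "x \<in> P" "y \<in> P" "\<rho> x < \<rho> y"
  shows "reduced_char_poly_on x y = reduced_char [:0, 1:] (\<lambda>i. of_nat (level_size i)) (\<rho> x) (\<rho> y)"
proof -
  let ?c = "\<lambda>i. of_nat (level_size i) :: real poly" and ?t = "[:0, 1:] :: real poly"
  let ?I = "{z \<in> P. \<rho> z \<in> {\<rho> x<..<\<rho> y}}"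
  have monom: "monom (of_int (mobius x z)) k = - (signed_prod ?c (\<rho> x) (\<rho> z) * ?t ^ k)"
    if "z \<in> P" "\<rho> x < \<rho> z" for z k
  proof -
    have "monom (of_int (mobius x z)) k = of_int (mobius x z) * ?t ^ k"
      by (simp add: monom_altdef of_int_poly)
    \<comment> \<open>Unfolding the product lets \<open>of_int\<close> pass from the integer factors
      to the polynomial ones.\<close>
    then show ?thesis
      using that assms(1) by (simp add: mobius_eq signed_prod_def)
  qed
  have "char_poly_on x y = (\<Sum>z\<in>insert x (insert y ?I). monom (of_int (mobius x z)) (\<rho> y - \<rho> z))"
    using assms by (simp add: char_poly_on_def interval_eq)
  also have "\<dots> = monom (of_int (mobius x x)) (\<rho> y - \<rho> x)
      + (monom (of_int (mobius x y)) (\<rho> y - \<rho> y)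
      + (\<Sum>z\<in>?I. monom (of_int (mobius x z)) (\<rho> y - \<rho> z)))"
    using assms finite_carrier by (subst sum.insert sum.insert; auto)+
  also have "monom (of_int (mobius x x)) (\<rho> y - \<rho> x) = ?t ^ (\<rho> y - \<rho> x)"
    by (simp add: mobius.simps monom_altdef)
  also have "(\<Sum>z\<in>?I. monom (of_int (mobius x z)) (\<rho> y - \<rho> z))
      = (\<Sum>z\<in>?I. - (signed_prod ?c (\<rho> x) (\<rho> z) * ?t ^ (\<rho> y - \<rho> z)))"
    by (intro sum.cong) (auto simp: monom)
  also have "\<dots> = (\<Sum>j\<in>{\<rho> x<..<\<rho> y}. ?c j * - (signed_prod ?c (\<rho> x) j * ?t ^ (\<rho> y - j)))"
    by (rule sum_by_rank) simp
  also have "monom (of_int (mobius x y)) (\<rho> y - \<rho> y) = - signed_prod ?c (\<rho> x) (\<rho> y)"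
    using assms by (simp add: monom)
  finally have "char_poly_on x y = (?t - 1) * reduced_char ?t ?c (\<rho> x) (\<rho> y)"
    unfolding reduced_char_telescope[OF assms(3)] by (simp add: sum_negf)
  also have "?t - 1 = [:-1, 1:]" by (simp add: one_pCons)
  finally have "[:-1, 1:] * reduced_char_poly_on x y = [:-1, 1:] * reduced_char ?t ?c (\<rho> x) (\<rho> y)"
    using assms by (subst reduced_char_poly_on_mult[symmetric]) (auto simp: order_iff)
  then show ?thesis
    by (subst (asm) mult_left_cancel) auto
qed

lemma chow_poly_on_hi:
  assumes "x \<in> P"
  shows "chow_poly_on x hi = chow_seq [:0, 1:] (\<lambda>i. of_nat (level_size i)) (\<rho> hi) (\<rho> x)"
  using assms
proof (induction "\<rho> hi - \<rho> x" arbitrary: x rule: less_induct)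
  case less
  let ?c = "\<lambda>i. of_nat (level_size i) :: real poly" and ?t = "[:0, 1:] :: real poly"
  show ?case
  proof (cases "x = hi")
    case True
    then show ?thesis by (simp add: chow_poly_on.simps chow_seq_def)
  next
    case False
    with less.prems have x: "\<rho> x < \<rho> hi" using hi_greatest[of x] by (auto simp: order_iff)
    \<comment> \<open>Since \<open>hi\<close> is alone on its rank, the top level can be taken whole
      here.\<close>
    have "interval x hi - {x} = {z \<in> P. \<rho> z \<in> {\<rho> x<..\<rho> hi}}"
      using less.prems x hi_in rank_le_hi
      by (auto simp: interval_def order_iff) (metis hi_greatest order_iff)
    then have "chow_poly_on x hi
        = (\<Sum>z\<in>{z \<in> P. \<rho> z \<in> {\<rho> x<..\<rho> hi}}. reduced_char_poly_on x z * chow_poly_on z hi)"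
      using False by (subst chow_poly_on.simps) auto
    also have "\<dots> = (\<Sum>z\<in>{z \<in> P. \<rho> z \<in> {\<rho> x<..\<rho> hi}}.
        reduced_char ?t ?c (\<rho> x) (\<rho> z) * chow_seq ?t ?c (\<rho> hi) (\<rho> z))"
      using less x by (intro sum.cong) (auto simp: reduced_char_poly_on_eq)
    also have "\<dots> = (\<Sum>j\<in>{\<rho> x<..\<rho> hi}.
        ?c j * (reduced_char ?t ?c (\<rho> x) j * chow_seq ?t ?c (\<rho> hi) j))"
      by (rule sum_by_rank) simp
    also have "\<dots> = chow_seq ?t ?c (\<rho> hi) (\<rho> x)"
      using x by (intro chow_seq_convolution) (auto simp: level_size_hi)
    finally show ?thesis .
  qed
qed

text \<open>Indexed from the top, because \<open>three_term\<close> builds the poset up from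
  \<open>hi\<close> downwards.\<close>

definition excess :: "nat \<Rightarrow> real" where
  "excess k = real (level_size (\<rho> hi - Suc k)) - 1"

text \<open>Levels are nonempty, and for large \<open>k\<close> the truncated subtraction lands on
  level 0.\<close>

lemma excess_nonneg: "excess k \<ge> 0"
  using level_size_pos[of "\<rho> hi - Suc k"] by (simp add: excess_def)

lemma excess_poly: "(of_nat (level_size (\<rho> hi - Suc k)) - 1 :: real poly) = [:excess k:]"
  by (simp add: excess_def of_nat_poly one_pCons)

lemma chow_poly_eq: "chow_poly = three_term [:0, 1:] (\<lambda>k. [:excess k:]) (\<rho> hi - 1)"
  by (simp add: chow_poly_def chow_poly_on_hi[OF lo_in] chow_seq_def rank_lo excess_poly)

lemma augmented_chow_poly_eq:
  "augmented_chow_poly = three_term [:0, 1:] (\<lambda>k. [:excess k:]) (\<rho> hi)"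
proof -
  let ?c = "\<lambda>i. of_nat (level_size i) :: real poly" and ?t = "[:0, 1:] :: real poly"
  have "P = {z \<in> P. \<rho> z \<in> {0..\<rho> hi}}" using rank_le_hi by auto
  then have "augmented_chow_poly
      = (\<Sum>z\<in>{z \<in> P. \<rho> z \<in> {0..\<rho> hi}}. ?t ^ \<rho> z * chow_seq ?t ?c (\<rho> hi) (\<rho> z))"
    unfolding augmented_chow_poly_def
    by (intro sum.cong) (auto simp: chow_poly_on_hi monom_altdef)
  also have "\<dots> = (\<Sum>j\<in>{0..\<rho> hi}. ?c j * (?t ^ j * chow_seq ?t ?c (\<rho> hi) j))"
    by (rule sum_by_rank) simp
  also have "\<dots> = tail_sum ?t ?c (\<rho> hi) (chow_seq ?t ?c (\<rho> hi)) 0"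
    by (simp add: tail_sum_def mult.assoc)
  also have "\<dots> = three_term ?t (\<lambda>k. ?c (\<rho> hi - Suc k) - 1) (\<rho> hi)"
    by (rule tail_sum_chow_seq) (simp_all add: level_size_lo level_size_hi)
  finally show ?thesis by (simp add: excess_poly)
qed

end

theorem theorem1p4:
  fixes P :: "'a set" and r :: "'a rel" and lo hi :: 'a and \<rho> :: "'a \<Rightarrow> nat"
  assumes "maximal_ranked_poset P r lo hi \<rho>"
  shows "only_real_zeros (finite_bounded_graded_poset.chow_poly P r lo hi \<rho>)
    \<and> only_real_zeros (finite_bounded_graded_poset.augmented_chow_poly P r hi \<rho>)"
proof -
  interpret maximal_ranked_poset P r lo hi \<rho> by (rule assms)
  show ?thesis
    unfolding chow_poly_eq augmented_chow_poly_eq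
    by (intro conjI only_real_zeros_three_term excess_nonneg)
qed

end
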